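(* Let $n\ge 2$, let $\alpha_i\in\mathbb R$ for $i\in\{1,\dots,n\}$ and let $x_{i,j}\in\mathbb R$ for $i\ne j$ in $\{1,\dots,n\}$. Fix $i$, let $\mathcal N_{XZ}(i)=\{j : x_{i,j}\neq0\}$ and $\deg_{XZ}(i)=|\mathcal N_{XZ}(i)|$. Then the quantity $$S_i=2^{-\deg_{XZ}(i)}\sum_{\lambda\in\{0,1\}^{\mathcal N_{XZ}(i)}}\max\Bigl\{\alpha_i+\sum_{j\in\mathcal N_{XZ}(i)}(-1)^{\lambda_j}x_{i,j},\,0\Bigr\}$$ can be efficiently approximated via Monte Carlo sampling up to additive error $\epsilon>0$ with failure probability $\delta\in(0,1)$ from $$\frac{16\,\deg_{XZ}(i)\,(\max_{j}|x_{i,j}|)^2\,\log(2/\delta)}{\epsilon^2}$$ many i.i.d. samples. That is, if $m\ge1$ is an integer at least this number and $\sigma^{(1)},\dots,\sigma^{(m)}$ are drawn independently and uniformly at random from $\{\pm1\}^{\mathcal N_{XZ}(i)}$, then with probability at least $1-\delta$, $$\Bigl|\frac1m\sum_{l=1}^m\max\Bigl\{\alpha_i+\sum_{j\in\mathcal N_{XZ}(i)}\sigma^{(l)}_jx_{i,j},\,0\Bigr\}-S_i\Bigr|\le\epsilon .$$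
   Context: Here $\log$ is the natural logarithm. The quantity $S_i$ is the non-stoquasticity $\nu_1\bigl(\alpha_iX_i+\sum_{j}x_{i,j}X_iZ_j\bigr)$ of the indicated $n$-qubit operator ($X_i,Z_j$ being Pauli matrices on the indicated qubits), where $\nu_1(H)$ is $2^{-n}$ times the sum of all positive off-diagonal entries of the $2^n\times2^n$ real matrix $H$ in the computational basis. *)

theory Defs
  imports "HOL-Probability.Probability"
begin

text \<open>
  Qubits are labelled by a finite type \<open>'n\<close>, so that \<open>n = CARD('n)\<close>.  The computational basis of
  \<open>n\<close> qubits is \<open>'n \<Rightarrow> bool\<close>, where \<open>True\<close> is the bit 1; an \<open>n\<close>-qubit operator with real entries
  is a square matrix indexed by it.
\<close>

type_synonym 'n operator = "real ^ ('n \<Rightarrow> bool) ^ ('n \<Rightarrow> bool)"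

definition pauli_X :: "real ^ bool ^ bool" where
  "pauli_X = (\<chi> a b. if a = b then 0 else 1)"

definition pauli_Z :: "real ^ bool ^ bool" where
  "pauli_Z = (\<chi> a b. if a = b then (if a then - 1 else 1) else 0)"

text \<open>The tensor product of \<open>A\<close> on qubit \<open>k\<close> with the identity on every other qubit.\<close>

definition on_qubit :: "real ^ bool ^ bool \<Rightarrow> 'n::finite \<Rightarrow> 'n operator" where
  "on_qubit A k = (\<chi> s t. \<Prod>l\<in>UNIV. (if l = k then A else mat 1) $ s l $ t l)"

definition nonstoq1 :: "'n::finite operator \<Rightarrow> real" where
  "nonstoq1 H = (\<Sum>(s, t) | s \<noteq> t \<and> H $ s $ t > 0. H $ s $ t) / 2 ^ CARD('n)"

text \<open>Only the values \<open>x i j\<close> with \<open>i \<noteq> j\<close> are meaningful; the diagonal of \<open>x\<close> is never used.\<close>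

definition N_XZ :: "('n::finite \<Rightarrow> 'n \<Rightarrow> real) \<Rightarrow> 'n \<Rightarrow> 'n set" where
  "N_XZ x i = {j. j \<noteq> i \<and> x i j \<noteq> 0}"

definition deg_XZ :: "('n::finite \<Rightarrow> 'n \<Rightarrow> real) \<Rightarrow> 'n \<Rightarrow> nat" where
  "deg_XZ x i = card (N_XZ x i)"

definition S_XZ :: "('n::finite \<Rightarrow> real) \<Rightarrow> ('n \<Rightarrow> 'n \<Rightarrow> real) \<Rightarrow> 'n \<Rightarrow> real" where
  "S_XZ \<alpha> x i = nonstoq1 (\<alpha> i *\<^sub>R on_qubit pauli_X i
     + (\<Sum>j\<in>UNIV - {i}. x i j *\<^sub>R (on_qubit pauli_X i ** on_qubit pauli_Z j)))"

definition sign_vectors :: "'n set \<Rightarrow> ('n \<Rightarrow> real) set" where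
  "sign_vectors N = N \<rightarrow>\<^sub>E {- 1, 1}"

end

theory Submission
  imports Defs
begin

text \<open>
  The operator only connects a basis state \<open>s\<close> with \<open>s\<close> flipped at qubit \<open>i\<close>, so its
  non-stoquasticity is the mean of \<open>max (\<alpha> i + \<Sum>j. \<sigma> j * x i j) 0\<close> over uniformly random
  signs \<open>\<sigma>\<close>.  Since the positive part is 1-Lipschitz, this random variable is sub-Gaussian with
  variance proxy \<open>\<Sum>j. (x i j)\<^sup>2\<close>: the signs are averaged out one at a time, each contributing a
  factor \<open>cosh u \<le> exp (u\<^sup>2 / 2)\<close> with \<open>\<bar>u\<bar> \<le> \<bar>l * x i j\<bar>\<close> to the moment generating function at
  \<open>l\<close>.  Chernoff's bound for the sum of the samples concludes.  (Hoeffding's inequality applied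
  to the range of the samples would cost a factor \<open>deg_XZ x i\<close>.)
\<close>

section \<open>Averages over uniformly random signs\<close>

text \<open>The offset \<open>a\<close> is an argument of its own because fixing one sign merely
  shifts it. The function \<open>g\<close> is arbitrary so that both the positive part and its
  exponential moments are covered.\<close>

definition rademacher_mean :: "'n set \<Rightarrow> ('n \<Rightarrow> real) \<Rightarrow> (real \<Rightarrow> real) \<Rightarrow> real \<Rightarrow> real" where
  "rademacher_mean N x g a =
     (\<Sum>\<sigma>\<in>sign_vectors N. g (a + (\<Sum>j\<in>N. \<sigma> j * x j))) / 2 ^ card N"

lemma finite_sign_vectors: "finite N \<Longrightarrow> finite (sign_vectors N)"
  unfolding sign_vectors_def by (intro finite_PiE) auto

lemma card_sign_vectors: "finite N \<Longrightarrow> card (sign_vectors N) = 2 ^ card N"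
  unfolding sign_vectors_def by (subst card_PiE) (auto simp: numeral_2_eq_2)

lemma rademacher_mean_empty: "rademacher_mean {} x g a = g a"
  by (simp add: rademacher_mean_def sign_vectors_def)

text \<open>Conditioning on the sign at \<open>k\<close> moves the offset to \<open>a + x k\<close>
  or \<open>a - x k\<close>, each with weight 1/2. This recursion drives the inductions on the index
  set.\<close>

lemma rademacher_mean_insert:
  assumes "finite N" "k \<notin> N"
  shows "rademacher_mean (insert k N) x g a =
           (rademacher_mean N x g (a + x k) + rademacher_mean N x g (a - x k)) / 2"
proof -
  let ?f = "\<lambda>\<sigma>. g (a + (\<Sum>j\<in>insert k N. \<sigma> j * x j))"
  have upd: "?f (\<sigma>(k := y)) = g ((a + y * x k) + (\<Sum>j\<in>N. \<sigma> j * x j))" for \<sigma> y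
  proof -
    have "(\<Sum>j\<in>N. (\<sigma>(k := y)) j * x j) = (\<Sum>j\<in>N. \<sigma> j * x j)"
      using assms by (intro sum.cong) auto
    then show ?thesis using assms by (simp add: add.assoc)
  qed
  have "(\<Sum>\<sigma>\<in>sign_vectors (insert k N). ?f \<sigma>) =
      (\<Sum>(y, \<sigma>)\<in>{- 1, 1} \<times> sign_vectors N. ?f (\<sigma>(k := y)))"
    unfolding sign_vectors_def PiE_insert_eq
    by (subst sum.reindex[OF inj_combinator[OF assms(2)]])
       (simp add: o_def case_prod_unfold)
  also have "\<dots> = (\<Sum>y\<in>{- 1, 1}. \<Sum>\<sigma>\<in>sign_vectors N. ?f (\<sigma>(k := y)))"
    by (simp add: sum.cartesian_product)
  also have "\<dots> = (\<Sum>\<sigma>\<in>sign_vectors N. g ((a - x k) + (\<Sum>j\<in>N. \<sigma> j * x j)))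
      + (\<Sum>\<sigma>\<in>sign_vectors N. g ((a + x k) + (\<Sum>j\<in>N. \<sigma> j * x j)))"
    unfolding upd by simp
  finally show ?thesis
    using assms by (simp add: rademacher_mean_def add_divide_distrib)
qed

lemma rademacher_mean_cong:
  "(\<And>j. j \<in> N \<Longrightarrow> x j = y j) \<Longrightarrow> rademacher_mean N x g a = rademacher_mean N y g a"
  by (simp add: rademacher_mean_def)

lemma rademacher_mean_mono_neutral:
  assumes "finite V" "N \<subseteq> V" "\<And>j. j \<in> V - N \<Longrightarrow> x j = 0"
  shows "rademacher_mean V x g a = rademacher_mean N x g a"
proof -
  \<comment> \<open>Indices are added to \<open>N\<close> one at a time: a zero coefficient makes
    both branches of the recursion equal.\<close>
  have "rademacher_mean (N \<union> W) x g a = rademacher_mean N x g a"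
    if "finite W" "W \<subseteq> V - N" for W
    using that
  proof (induction W rule: finite_induct)
    case (insert k W)
    moreover have "finite (N \<union> W)" using insert assms(1,2) finite_subset by blast
    moreover have "k \<notin> N \<union> W" "x k = 0" using insert assms(3) by auto
    ultimately show ?case by (simp add: rademacher_mean_insert)
  qed simp
  from this[of "V - N"] assms(1,2) show ?thesis by (simp add: Un_absorb1 Un_Diff_cancel)
qed

text \<open>Averaging preserves the Lipschitz constant, since equal shifts of \<open>a\<close> and
  \<open>b\<close> keep their distance. This controls the gap between the two conditional means when
  a sign is averaged out.\<close>

lemma rademacher_mean_lipschitz:
  assumes g: "\<And>s t. \<bar>g s - g t\<bar> \<le> \<bar>s - t\<bar>" and "finite N"
  shows "\<bar>rademacher_mean N x g a - rademacher_mean N x g b\<bar> \<le> \<bar>a - b\<bar>"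
  using assms(2)
proof (induction N arbitrary: a b rule: finite_induct)
  case (insert k N)
  show ?case
    using insert.IH[of "a + x k" "b + x k"] insert.IH[of "a - x k" "b - x k"]
    unfolding rademacher_mean_insert[OF insert.hyps] by argo
qed (simp add: rademacher_mean_empty g)

section \<open>Sub-Gaussian moment bound\<close>

text \<open>This is Hoeffding's lemma for a fair coin: \<open>exp v * cosh v\<close> is the moment
  generating function at \<open>2 * v\<close> of a coin with values 0 and 1, and its centred
  logarithm is at most \<open>(2 * v)\<^sup>2 / 8\<close>. Negative arguments follow by
  symmetry.\<close>

lemma cosh_le_exp_half_square:
  fixes u :: real
  shows "cosh u \<le> exp (u\<^sup>2 / 2)"
proof -
  have *: "cosh v \<le> exp (v\<^sup>2 / 2)" if "v \<ge> 0" for v :: real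
  proof -
    have "1 + (exp (2 * v) - 1) / 2 = exp v * cosh v"
      by (simp add: cosh_def field_simps flip: exp_add)
    then have "ln (1 + (1/2) * (exp (2 * v) - 1)) = v + ln (cosh v)"
      by (simp add: ln_mult)
    then have "ln (cosh v) \<le> v\<^sup>2 / 2"
      using Hoeffdings_lemma_aux[of "2 * v" "1/2"] that by (simp add: power_mult_distrib)
    then show ?thesis by (metis cosh_real_pos exp_le_cancel_iff exp_ln)
  qed
  show ?thesis using *[of "\<bar>u\<bar>"] by (simp add: cosh_real_abs)
qed

lemma rademacher_mean_exp_le:
  assumes g: "\<And>s t. \<bar>g s - g t\<bar> \<le> \<bar>s - t\<bar>" and "finite N"
  shows "rademacher_mean N x (\<lambda>s. exp (l * g s)) a
           \<le> exp (l * rademacher_mean N x g a + l\<^sup>2 * (\<Sum>j\<in>N. (x j)\<^sup>2) / 2)"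
  using assms(2)
proof (induction N arbitrary: a rule: finite_induct)
  case (insert k N)
  let ?p = "rademacher_mean N x g (a + x k)" and ?q = "rademacher_mean N x g (a - x k)"
  define V where "V = l\<^sup>2 * (\<Sum>j\<in>N. (x j)\<^sup>2) / 2"
  \<comment> \<open>The two conditional exponents lie at distance \<open>u\<close> on either side of
    their midpoint, so averaging their exponentials produces the factor
    \<open>cosh u\<close>.\<close>
  define u where "u = l * ((?p - ?q) / 2)"
  have "\<bar>(?p - ?q) / 2\<bar> \<le> \<bar>x k\<bar>"
    using rademacher_mean_lipschitz[OF g insert.hyps(1), of x "a + x k" "a - x k"] by simp
  then have "((?p - ?q) / 2)\<^sup>2 \<le> (x k)\<^sup>2" by (simp only: abs_le_square_iff)
  then have u: "u\<^sup>2 \<le> l\<^sup>2 * (x k)\<^sup>2"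
    unfolding u_def power_mult_distrib by (intro mult_left_mono) auto
  have "rademacher_mean (insert k N) x (\<lambda>s. exp (l * g s)) a
      \<le> (exp (l * ?p + V) + exp (l * ?q + V)) / 2"
    unfolding rademacher_mean_insert[OF insert.hyps]
    using insert.IH[of "a + x k"] insert.IH[of "a - x k"] by (simp add: V_def)
  also have "\<dots> = exp (l * ((?p + ?q) / 2) + V) * cosh u"
  proof -
    have p: "l * ?p + V = l * ((?p + ?q) / 2) + V + u"
      and q: "l * ?q + V = l * ((?p + ?q) / 2) + V + - u"
      by (simp_all add: u_def field_simps)
    show ?thesis
      unfolding p q exp_add[of _ u] exp_add[of _ "- u"] by (simp add: cosh_def field_simps)
  qed
  also have "\<dots> \<le> exp (l * ((?p + ?q) / 2) + V) * exp (l\<^sup>2 * (x k)\<^sup>2 / 2)"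
    using cosh_le_exp_half_square[of u] u by (intro mult_left_mono) (auto elim: order_trans)
  also have "\<dots> = exp (l * rademacher_mean (insert k N) x g a
      + l\<^sup>2 * (\<Sum>j\<in>insert k N. (x j)\<^sup>2) / 2)"
    unfolding rademacher_mean_insert[OF insert.hyps] using insert.hyps
    by (simp add: V_def field_simps flip: exp_add)
  finally show ?case .
qed (simp add: rademacher_mean_empty)

section \<open>Tail bounds for independent sub-Gaussian variables\<close>

text \<open>Markov's inequality is applied to the exponential of the sum, whose expectation
  factorises by independence. Stating \<open>mgf\<close> with the nonnegative integral avoids
  integrability side conditions.\<close>

lemma (in prob_space) subgaussian_sum_tail_ge:
  fixes X :: "'b \<Rightarrow> 'a \<Rightarrow> real"
  assumes I: "finite I" "I \<noteq> {}" and ind: "indep_vars (\<lambda>_. borel) X I"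
    and v: "v > 0" and \<epsilon>: "\<epsilon> > 0"
    and mgf: "\<And>i l. i \<in> I \<Longrightarrow> (\<integral>\<^sup>+\<omega>. exp (l * X i \<omega>) \<partial>M) \<le> ennreal (exp (l\<^sup>2 * v / 2))"
  shows "prob {\<omega> \<in> space M. (\<Sum>i\<in>I. X i \<omega>) \<ge> \<epsilon>} \<le> exp (- \<epsilon>\<^sup>2 / (2 * real (card I) * v))"
proof -
  define c where "c = real (card I)"
  have c: "c > 0" using I by (simp add: c_def card_gt_0_iff)
  \<comment> \<open>This value minimises the exponent
    \<open>- l * \<epsilon> + c * (l\<^sup>2 * v / 2)\<close>.\<close>
  define l where "l = \<epsilon> / (c * v)"
  have l: "l > 0" using c v \<epsilon> by (simp add: l_def)
  have [measurable]: "random_variable borel (X i)" if "i \<in> I" for i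
    using ind that unfolding indep_vars_def by blast
  have "ennreal (prob {\<omega> \<in> space M. (\<Sum>i\<in>I. X i \<omega>) \<ge> \<epsilon>})
      \<le> ennreal (exp (- l * \<epsilon>)) * (\<integral>\<^sup>+\<omega>\<in>space M. exp (l * (\<Sum>i\<in>I. X i \<omega>)) \<partial>M)"
    unfolding emeasure_eq_measure[symmetric]
    by (intro Chernoff_ineq_nn_integral_ge l) auto
  also have "(\<integral>\<^sup>+\<omega>\<in>space M. exp (l * (\<Sum>i\<in>I. X i \<omega>)) \<partial>M)
      = (\<integral>\<^sup>+\<omega>. (\<Prod>i\<in>I. ennreal (exp (l * X i \<omega>))) \<partial>M)"
    by (intro nn_integral_cong) (simp add: sum_distrib_left exp_sum I prod_ennreal)
  also have "\<dots> = (\<Prod>i\<in>I. \<integral>\<^sup>+\<omega>. exp (l * X i \<omega>) \<partial>M)"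
    by (intro indep_vars_nn_integral I indep_vars_compose2[OF ind]) auto
  also have "\<dots> \<le> (\<Prod>i\<in>I. ennreal (exp (l\<^sup>2 * v / 2)))"
    by (intro prod_mono_ennreal mgf)
  also have "\<dots> = ennreal (exp (c * (l\<^sup>2 * v / 2)))"
    by (simp add: prod_ennreal c_def ennreal_power exp_of_nat_mult[symmetric])
  finally have "ennreal (prob {\<omega> \<in> space M. (\<Sum>i\<in>I. X i \<omega>) \<ge> \<epsilon>})
      \<le> ennreal (exp (- l * \<epsilon>) * exp (c * (l\<^sup>2 * v / 2)))"
    by (simp add: mult_left_mono ennreal_mult)
  then have "prob {\<omega> \<in> space M. (\<Sum>i\<in>I. X i \<omega>) \<ge> \<epsilon>} \<le> exp (- l * \<epsilon> + c * (l\<^sup>2 * v / 2))"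
    by (subst (asm) ennreal_le_iff) (simp_all only: exp_add mult_nonneg_nonneg exp_ge_zero)
  also have "- l * \<epsilon> + c * (l\<^sup>2 * v / 2) = - \<epsilon>\<^sup>2 / (2 * real (card I) * v)"
    unfolding c_def[symmetric] l_def using c v by (simp add: field_simps power2_eq_square)
  finally show ?thesis .
qed

text \<open>A union bound over the upper tails of the sum and of its negation. Since
  \<open>mgf\<close> ranges over all real \<open>l\<close>, it also covers the negated
  variables.\<close>

lemma (in prob_space) subgaussian_sum_tail_abs:
  fixes X :: "'b \<Rightarrow> 'a \<Rightarrow> real"
  assumes I: "finite I" "I \<noteq> {}" and ind: "indep_vars (\<lambda>_. borel) X I"
    and v: "v > 0" and \<epsilon>: "\<epsilon> > 0"
    and mgf: "\<And>i l. i \<in> I \<Longrightarrow> (\<integral>\<^sup>+\<omega>. exp (l * X i \<omega>) \<partial>M) \<le> ennreal (exp (l\<^sup>2 * v / 2))"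
  shows "prob {\<omega> \<in> space M. \<bar>\<Sum>i\<in>I. X i \<omega>\<bar> \<ge> \<epsilon>} \<le> 2 * exp (- \<epsilon>\<^sup>2 / (2 * real (card I) * v))"
proof -
  have [measurable]: "random_variable borel (X i)" if "i \<in> I" for i
    using ind that unfolding indep_vars_def by blast
  have neg: "indep_vars (\<lambda>_. borel) (\<lambda>i \<omega>. - X i \<omega>) I"
    by (intro indep_vars_compose2[OF ind]) auto
  have "{\<omega> \<in> space M. \<bar>\<Sum>i\<in>I. X i \<omega>\<bar> \<ge> \<epsilon>} =
      {\<omega> \<in> space M. (\<Sum>i\<in>I. X i \<omega>) \<ge> \<epsilon>} \<union> {\<omega> \<in> space M. (\<Sum>i\<in>I. - X i \<omega>) \<ge> \<epsilon>}"
    by (auto simp: sum_negf)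
  also have "prob \<dots> \<le> prob {\<omega> \<in> space M. (\<Sum>i\<in>I. X i \<omega>) \<ge> \<epsilon>}
      + prob {\<omega> \<in> space M. (\<Sum>i\<in>I. - X i \<omega>) \<ge> \<epsilon>}"
    by (intro measure_Un_le) auto
  also have "prob {\<omega> \<in> space M. (\<Sum>i\<in>I. - X i \<omega>) \<ge> \<epsilon>}
      \<le> exp (- \<epsilon>\<^sup>2 / (2 * real (card I) * v))"
    using mgf[of _ "- l" for l] by (intro subgaussian_sum_tail_ge I neg v \<epsilon>) simp
  also have "prob {\<omega> \<in> space M. (\<Sum>i\<in>I. X i \<omega>) \<ge> \<epsilon>} \<le> exp (- \<epsilon>\<^sup>2 / (2 * real (card I) * v))"
    by (intro subgaussian_sum_tail_ge assms)
  finally show ?thesis by simp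
qed

section \<open>From Pauli operators to sign averages\<close>

lemma prod_of_bool: "finite A \<Longrightarrow> (\<Prod>l\<in>A. of_bool (P l)) = (of_bool (\<forall>l\<in>A. P l) :: real)"
  by (induction A rule: finite_induct) auto

lemma on_qubit_pauli_X:
  "on_qubit pauli_X i $ s $ t = of_bool (t = s(i := \<not> s i))"
proof -
  have "on_qubit pauli_X i $ s $ t = (\<Prod>l\<in>UNIV. of_bool (t l = (s(i := \<not> s i)) l))"
    unfolding on_qubit_def by (auto simp: pauli_X_def mat_def intro!: prod.cong)
  then show ?thesis by (simp add: prod_of_bool fun_eq_iff)
qed

lemma on_qubit_pauli_Z:
  "on_qubit pauli_Z j $ s $ t = of_bool (s = t) * (if t j then - 1 else 1)"
proof -
  have "on_qubit pauli_Z j $ s $ t =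
      (\<Prod>l\<in>UNIV. of_bool (s l = t l) * (if l = j then if t j then - 1 else 1 else 1))"
    unfolding on_qubit_def by (auto simp: pauli_Z_def mat_def intro!: prod.cong)
  then show ?thesis by (simp add: prod.distrib prod_of_bool fun_eq_iff)
qed

text \<open>Row \<open>s\<close> of the bit flip selects a single intermediate state, on which the
  second factor is diagonal. The sign is read from the column state \<open>t\<close>, which agrees
  with \<open>s\<close> at every \<open>j\<close> other than \<open>i\<close>.\<close>

lemma pauli_X_Z_entry:
  "(on_qubit pauli_X i ** on_qubit pauli_Z j) $ s $ t
     = of_bool (t = s(i := \<not> s i)) * (if t j then - 1 else 1)"
proof -
  have "(on_qubit pauli_X i ** on_qubit pauli_Z j) $ s $ t =
      (\<Sum>u\<in>UNIV. if u = s(i := \<not> s i) then of_bool (u = t) * (if t j then - 1 else 1) else 0)"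
    unfolding matrix_matrix_mult_def by (auto simp: on_qubit_pauli_X on_qubit_pauli_Z intro!: sum.cong)
  also have "\<dots> = of_bool (t = s(i := \<not> s i)) * (if t j then - 1 else 1)"
    by (subst sum.delta) auto
  finally show ?thesis .
qed

text \<open>Flipping bit \<open>i\<close> never fixes a state, so the only possibly nonzero entry of
  row \<open>s\<close> is off-diagonal and equals \<open>h s\<close>. It counts exactly when
  \<open>h s\<close> is positive.\<close>

lemma nonstoq1_bit_flip:
  fixes H :: "'n::finite operator"
  assumes "\<And>s t. H $ s $ t = of_bool (t = s(i := \<not> s i)) * h s"
  shows "nonstoq1 H = (\<Sum>s\<in>UNIV. max (h s) 0) / 2 ^ CARD('n)"
proof -
  have ne: "s \<noteq> s(i := \<not> s i)" for s :: "'n \<Rightarrow> bool" by (metis fun_upd_same)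
  have "(\<Sum>(s, t) | s \<noteq> t \<and> H $ s $ t > 0. H $ s $ t) = (\<Sum>s | h s > 0. h s)"
    using ne by (intro sum.reindex_bij_witness[where j = fst and i = "\<lambda>s. (s, s(i := \<not> s i))"])
       (auto simp: assms of_bool_def split: if_splits)
  also have "\<dots> = (\<Sum>s\<in>UNIV. max (h s) 0)"
    by (intro sum.mono_neutral_cong_left) (auto simp: max_def)
  finally show ?thesis by (simp add: nonstoq1_def)
qed

lemma S_XZ_eq_rademacher_mean:
  "S_XZ \<alpha> x i = rademacher_mean (N_XZ x i) (x i) (\<lambda>s. max s 0) (\<alpha> i)"
proof -
  \<comment> \<open>Putting 0 at \<open>i\<close> lets the sum run over all qubits, so that the
    basis states correspond bijectively to sign vectors on \<open>UNIV\<close>. The zero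
    coefficients are averaged out afterwards.\<close>
  define y where "y j = (if j = i then 0 else x i j)" for j
  define sg where "sg s j = (if s j then - 1 else 1 :: real)" for s :: "'a \<Rightarrow> bool" and j
  have "S_XZ \<alpha> x i = (\<Sum>s\<in>UNIV. max (\<alpha> i + (\<Sum>j\<in>UNIV. sg s j * y j)) 0) / 2 ^ CARD('a)"
    unfolding S_XZ_def
  proof (rule nonstoq1_bit_flip)
    fix s t :: "'a \<Rightarrow> bool"
    have "(\<Sum>j\<in>UNIV. sg s j * y j) = (\<Sum>j\<in>UNIV - {i}. sg s j * x i j)"
      by (intro sum.mono_neutral_cong_right) (auto simp: y_def)
    then show "(\<alpha> i *\<^sub>R on_qubit pauli_X i
          + (\<Sum>j\<in>UNIV - {i}. x i j *\<^sub>R (on_qubit pauli_X i ** on_qubit pauli_Z j))) $ s $ t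
        = of_bool (t = s(i := \<not> s i)) * (\<alpha> i + (\<Sum>j\<in>UNIV. sg s j * y j))"
      by (auto simp: on_qubit_pauli_X pauli_X_Z_entry sg_def intro!: sum.cong)
  qed
  also have "(\<Sum>s\<in>UNIV. max (\<alpha> i + (\<Sum>j\<in>UNIV. sg s j * y j)) 0)
      = (\<Sum>\<sigma>\<in>sign_vectors UNIV. max (\<alpha> i + (\<Sum>j\<in>UNIV. \<sigma> j * y j)) 0)"
    by (rule sum.reindex_bij_witness[where j = sg and i = "\<lambda>\<sigma> j. \<sigma> j = - 1"])
       (auto simp: sg_def sign_vectors_def fun_eq_iff PiE_iff)
  also have "\<dots> / 2 ^ CARD('a) = rademacher_mean UNIV y (\<lambda>s. max s 0) (\<alpha> i)"
    by (simp add: rademacher_mean_def)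
  also have "\<dots> = rademacher_mean (N_XZ x i) y (\<lambda>s. max s 0) (\<alpha> i)"
    by (rule rademacher_mean_mono_neutral) (auto simp: y_def N_XZ_def)
  also have "\<dots> = rademacher_mean (N_XZ x i) (x i) (\<lambda>s. max s 0) (\<alpha> i)"
    by (rule rademacher_mean_cong) (auto simp: y_def N_XZ_def)
  finally show ?thesis .
qed

text \<open>Sending a bit \<open>b\<close> to \<open>(- 1) ^ b\<close> in each coordinate is a
  bijection onto the sign vectors; restriction to \<open>N\<close> keeps the functions
  extensional.\<close>

lemma rademacher_mean_bits:
  "rademacher_mean N x g a =
    (\<Sum>b\<in>N \<rightarrow>\<^sub>E {0, 1::nat}. g (a + (\<Sum>j\<in>N. (- 1) ^ b j * x j))) / 2 ^ card N"
proof -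
  have "(\<Sum>b\<in>N \<rightarrow>\<^sub>E {0, 1::nat}. g (a + (\<Sum>j\<in>N. (- 1) ^ b j * x j))) =
      (\<Sum>\<sigma>\<in>sign_vectors N. g (a + (\<Sum>j\<in>N. \<sigma> j * x j)))"
    unfolding sign_vectors_def
    by (rule sum.reindex_bij_witness[where j = "\<lambda>b. \<lambda>j\<in>N. (- 1) ^ b j"
          and i = "\<lambda>\<sigma>. \<lambda>j\<in>N. if \<sigma> j = - 1 then 1 else 0"])
       (fastforce simp: PiE_iff extensional_def fun_eq_iff)+
  then show ?thesis by (simp add: rademacher_mean_def)
qed

section \<open>The Monte Carlo guarantee\<close>

lemma nn_integral_uniform_sign_vectors:
  assumes "finite N" "\<And>s. g s \<ge> 0"
  shows "(\<integral>\<^sup>+\<sigma>. g (a + (\<Sum>j\<in>N. \<sigma> j * x j)) \<partial>uniform_count_measure (sign_vectors N))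
           = ennreal (rademacher_mean N x g a)"
  using assms
  by (simp add: uniform_count_measure_def nn_integral_point_measure_finite finite_sign_vectors
      card_sign_vectors rademacher_mean_def sum_divide_distrib divide_ennreal flip: ennreal_mult)

theorem theorem6:
  fixes \<alpha> :: "'n::finite \<Rightarrow> real" and x :: "'n \<Rightarrow> 'n \<Rightarrow> real" and i :: 'n
    and \<epsilon> \<delta> :: real and m :: nat
    and M :: "'w measure" and \<sigma> :: "nat \<Rightarrow> 'w \<Rightarrow> 'n \<Rightarrow> real"
  assumes "CARD('n) \<ge> 2"
    and "\<epsilon> > 0" and "0 < \<delta>" and "\<delta> < 1"
    and "m \<ge> 1"
    and "real m \<ge> 16 * real (deg_XZ x i) * (Max ((\<lambda>j. \<bar>x i j\<bar>) ` (UNIV - {i})))\<^sup>2 * ln (2 / \<delta>) / \<epsilon>\<^sup>2"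
    and "prob_space M"
    and "prob_space.indep_vars M (\<lambda>_. count_space (sign_vectors (N_XZ x i))) \<sigma> {1..m}"
    and "\<And>l. l \<in> {1..m} \<Longrightarrow>
      distr M (count_space (sign_vectors (N_XZ x i))) (\<sigma> l) = uniform_count_measure (sign_vectors (N_XZ x i))"
  shows "S_XZ \<alpha> x i = (\<Sum>b\<in>N_XZ x i \<rightarrow>\<^sub>E {0, 1::nat}.
            max (\<alpha> i + (\<Sum>j\<in>N_XZ x i. (- 1) ^ b j * x i j)) 0) / 2 ^ deg_XZ x i
    \<and> measure M {\<omega> \<in> space M.
            \<bar>(\<Sum>l=1..m. max (\<alpha> i + (\<Sum>j\<in>N_XZ x i. \<sigma> l \<omega> j * x i j)) 0) / real m - S_XZ \<alpha> x i\<bar> \<le> \<epsilon>} \<ge> 1 - \<delta>"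
proof
  let ?N = "N_XZ x i" and ?g = "\<lambda>s::real. max s 0"
  let ?f = "\<lambda>\<sigma>. ?g (\<alpha> i + (\<Sum>j\<in>?N. \<sigma> j * x i j))"
  define S where "S = S_XZ \<alpha> x i"
  have S: "S = rademacher_mean ?N (x i) ?g (\<alpha> i)"
    unfolding S_def by (rule S_XZ_eq_rademacher_mean)
  show "S_XZ \<alpha> x i = (\<Sum>b\<in>?N \<rightarrow>\<^sub>E {0, 1::nat}.
      max (\<alpha> i + (\<Sum>j\<in>?N. (- 1) ^ b j * x i j)) 0) / 2 ^ deg_XZ x i"
    unfolding S_XZ_eq_rademacher_mean rademacher_mean_bits deg_XZ_def ..
  interpret prob_space M by fact
  define L where "L = ln (2 / \<delta>)"
  have L: "L > 0" using assms(3,4) by (simp add: L_def)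
  \<comment> \<open>The largest variance proxy for which the tail bound is \<open>\<delta>\<close>; unlike \<open>\<Sum>j. (x i j)\<^sup>2\<close> it is
    positive even when \<open>N_XZ x i\<close> is empty.\<close>
  define v where "v = real m * \<epsilon>\<^sup>2 / (2 * L)"
  have v: "v > 0" using assms(2,5) L by (simp add: v_def)
  define B where "B = Max ((\<lambda>j. \<bar>x i j\<bar>) ` (UNIV - {i}))"
  have B: "\<bar>x i j\<bar> \<le> B" if "j \<in> ?N" for j
    using that unfolding B_def by (intro Max_ge) (auto simp: N_XZ_def)
  have "(\<Sum>j\<in>?N. (x i j)\<^sup>2) \<le> (\<Sum>j\<in>?N. B\<^sup>2)"
    using B by (intro sum_mono) (metis abs_ge_zero power2_abs power_mono)
  also have "\<dots> = real (deg_XZ x i) * B\<^sup>2" by (simp add: deg_XZ_def)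
  also have "\<dots> \<le> v"
  proof -
    have "16 * (real (deg_XZ x i) * B\<^sup>2) * L \<le> real m * \<epsilon>\<^sup>2"
      using assms(2,6) by (simp add: B_def L_def divide_simps mult_ac)
    \<comment> \<open>Nonnegativity permits passing from the constant 16 of the sample count to the
      2 in the definition of \<open>v\<close>.\<close>
    moreover have "0 \<le> real (deg_XZ x i) * B\<^sup>2 * L" using L by simp
    ultimately have "real (deg_XZ x i) * B\<^sup>2 * (2 * L) \<le> real m * \<epsilon>\<^sup>2" by linarith
    then show ?thesis using L by (simp add: v_def pos_le_divide_eq)
  qed
  finally have xv: "(\<Sum>j\<in>?N. (x i j)\<^sup>2) \<le> v" .
  have rv [measurable]: "\<sigma> l \<in> M \<rightarrow>\<^sub>M count_space (sign_vectors ?N)" if "l \<in> {1..m}" for l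
    using assms(8) that unfolding indep_vars_def by blast
  define X where "X l \<omega> = ?f (\<sigma> l \<omega>) - S" for l \<omega>
  have ind: "indep_vars (\<lambda>_. borel) X {1..m}"
    unfolding X_def by (rule indep_vars_compose2[OF assms(8)]) simp
  have [measurable]: "random_variable borel (X l)" if "l \<in> {1..m}" for l
    using ind that unfolding indep_vars_def by blast
  have mgf: "(\<integral>\<^sup>+\<omega>. exp (t * X l \<omega>) \<partial>M) \<le> ennreal (exp (t\<^sup>2 * v / 2))" if "l \<in> {1..m}" for l t
  proof -
    let ?h = "\<lambda>s. exp (t * ?g s)"
    \<comment> \<open>Splitting off the centring factor \<open>exp (- t * S)\<close> leaves an
      integrand that can be pushed forward to the uniform law of \<open>\<sigma> l\<close>.\<close>
    have "(\<integral>\<^sup>+\<omega>. exp (t * X l \<omega>) \<partial>M) =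
        (\<integral>\<^sup>+\<omega>. ennreal (exp (- t * S)) * ennreal (exp (t * ?f (\<sigma> l \<omega>))) \<partial>M)"
      by (simp add: X_def algebra_simps flip: ennreal_mult exp_add)
    also have "\<dots> = (\<integral>\<^sup>+\<sigma>. ennreal (exp (- t * S)) * ennreal (exp (t * ?f \<sigma>))
        \<partial>distr M (count_space (sign_vectors ?N)) (\<sigma> l))"
      using rv[OF that] by (subst nn_integral_distr) auto
    also have "\<dots> = ennreal (exp (- t * S)) *
        (\<integral>\<^sup>+\<sigma>. ?h (\<alpha> i + (\<Sum>j\<in>?N. \<sigma> j * x i j)) \<partial>distr M (count_space (sign_vectors ?N)) (\<sigma> l))"
      by (rule nn_integral_cmult) simp
    also have "\<dots> = ennreal (exp (- t * S)) * ennreal (rademacher_mean ?N (x i) ?h (\<alpha> i))"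
      unfolding assms(9)[OF that] by (subst nn_integral_uniform_sign_vectors) auto
    \<comment> \<open>The positive part is 1-Lipschitz and its mean is \<open>S\<close>, so the
      centring factor will cancel the linear term of the exponent.\<close>
    also have "\<dots> \<le> ennreal (exp (- t * S) * exp (t * S + t\<^sup>2 * (\<Sum>j\<in>?N. (x i j)\<^sup>2) / 2))"
      unfolding S ennreal_mult'[OF exp_ge_zero]
      by (intro mult_left_mono ennreal_leI rademacher_mean_exp_le) (auto simp: max_def)
    also have "\<dots> \<le> ennreal (exp (t\<^sup>2 * v / 2))"
      using mult_left_mono[OF xv, of "t\<^sup>2"] by (intro ennreal_leI) (simp flip: exp_add)
    finally show ?thesis .
  qed
  let ?P = "\<lambda>\<omega>. \<bar>(\<Sum>l=1..m. ?f (\<sigma> l \<omega>)) / real m - S\<bar> \<le> \<epsilon>"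
  have P: "?P \<omega> \<longleftrightarrow> \<bar>\<Sum>l=1..m. X l \<omega>\<bar> \<le> real m * \<epsilon>" for \<omega>
  proof -
    have "(\<Sum>l=1..m. ?f (\<sigma> l \<omega>)) / real m - S = (\<Sum>l=1..m. X l \<omega>) / real m"
      using assms(5) by (simp add: X_def sum_subtractf field_simps)
    then show ?thesis using assms(5) by (simp add: abs_divide divide_le_eq mult.commute)
  qed
  have "1 - prob {\<omega> \<in> space M. ?P \<omega>} = prob {\<omega> \<in> space M. \<not> ?P \<omega>}"
    unfolding P by (subst prob_neg) auto
  \<comment> \<open>The failure event has a strict inequality; it is enlarged to the closed tail
    event.\<close>
  also have "\<dots> \<le> prob {\<omega> \<in> space M. \<bar>\<Sum>l=1..m. X l \<omega>\<bar> \<ge> real m * \<epsilon>}"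
    unfolding P by (intro finite_measure_mono) auto
  also have "\<dots> \<le> 2 * exp (- (real m * \<epsilon>)\<^sup>2 / (2 * real (card {1..m}) * v))"
    using assms(2,5) by (intro subgaussian_sum_tail_abs ind v mgf) auto
  \<comment> \<open>The exponent is \<open>- real m * \<epsilon>\<^sup>2 / (2 * v)\<close>, which
    the choice of \<open>v\<close> makes exactly \<open>- L\<close>.\<close>
  also have "- (real m * \<epsilon>)\<^sup>2 / (2 * real (card {1..m}) * v) = - L"
    using assms(2,5) L by (simp add: v_def field_simps power2_eq_square)
  also have "2 * exp (- L) = \<delta>"
    using assms(3) by (simp add: L_def exp_minus)
  finally show "1 - \<delta> \<le> prob {\<omega> \<in> space M.
      \<bar>(\<Sum>l=1..m. max (\<alpha> i + (\<Sum>j\<in>?N. \<sigma> l \<omega> j * x i j)) 0) / real m - S_XZ \<alpha> x i\<bar> \<le> \<epsilon>}"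
    unfolding S_def by simp
qed

end
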